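(* Let $k$ be a positive integer and let $T$ be a string of length $n$. The total number of $k$-runs in $T$ (over all periods $\ell\in[1\mathinner{.\,.}\lfloor n/2\rfloor]$) is $\mathcal{O}(nk\log k)$.
   Context: Positions of a string $T$ are numbered $1,\dots,|T|$; $T[i\mathinner{.\,.} j]=T[i\mathinner{.\,.} j+1)$ denotes the substring $T[i]T[i+1]\cdots T[j]$, and $[i\mathinner{.\,.} j]=[i\mathinner{.\,.} j+1)=\{i,\dots,j\}$. For equal-length strings $X,Y$, the Hamming distance is $d_H(X,Y)=|\{i: X[i]\ne Y[i]\}|$. A $k$-mismatch square is a string $XY$ with $|X|=|Y|$ and $d_H(X,Y)\le k$. A $k$-run of period $\ell$ in $T$ is a substring $T[a\mathinner{.\,.} b)$ with $b-a\ge 2\ell$ such that $T[i\mathinner{.\,.} i+2\ell)$ is a $k$-mismatch square for every $i\in[a\mathinner{.\,.} b-2\ell]$, and which is maximal, i.e., it cannot be extended to the left or to the right while still satisfying this property for the same $\ell$. A $k$-run is identified by the triple $(a,b,\ell)$.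
   Formalization: The factor log k is read as max(1, log₂ k): for k = 1 the literal bound would be 0, which fails already for T = aa (it has a 1-run of period 1); for k ≥ 2 the bound is exactly O(nk log k) with one absolute constant. *)

theory Defs
  imports Complex_Main
begin

text \<open>Positions of a string are numbered from 1, whereas list indexing is 0-based;
  \<open>substr T i j\<close> is the half-open substring \<open>T[i..j)\<close>, for \<open>1 \<le> i \<le> j \<le> length T + 1\<close>.\<close>

definition substr :: "'a list \<Rightarrow> nat \<Rightarrow> nat \<Rightarrow> 'a list" where
  "substr T i j = take (j - i) (drop (i - 1) T)"

text \<open>Only meaningful for lists of equal length.\<close>

definition hamming_dist :: "'a list \<Rightarrow> 'a list \<Rightarrow> nat" where
  "hamming_dist X Y = card {i. i < length X \<and> X ! i \<noteq> Y ! i}"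

definition mismatch_square :: "nat \<Rightarrow> 'a list \<Rightarrow> bool" where
  "mismatch_square k S \<longleftrightarrow>
     (\<exists>X Y. S = X @ Y \<and> length X = length Y \<and> hamming_dist X Y \<le> k)"

definition k_repetition :: "nat \<Rightarrow> 'a list \<Rightarrow> nat \<Rightarrow> nat \<Rightarrow> nat \<Rightarrow> bool" where
  "k_repetition k T a b l \<longleftrightarrow>
     1 \<le> a \<and> b \<le> length T + 1 \<and> a + 2 * l \<le> b \<and>
     (\<forall>i\<in>{a..b - 2 * l}. mismatch_square k (substr T i (i + 2 * l)))"

definition is_k_run :: "nat \<Rightarrow> 'a list \<Rightarrow> nat \<Rightarrow> nat \<Rightarrow> nat \<Rightarrow> bool" where
  "is_k_run k T a b l \<longleftrightarrow>
     k_repetition k T a b l \<and>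
     (\<forall>a' b'. a' \<le> a \<and> b \<le> b' \<and> k_repetition k T a' b' l \<longrightarrow> a' = a \<and> b' = b)"

definition k_runs :: "nat \<Rightarrow> 'a list \<Rightarrow> (nat \<times> nat \<times> nat) set" where
  "k_runs k T = {(a, b, l). l \<in> {1..length T div 2} \<and> is_k_run k T a b l}"

lemma finite_k_runs: "finite (k_runs k T)"
proof (rule finite_subset)
  show "k_runs k T \<subseteq> {..length T + 1} \<times> {..length T + 1} \<times> {..length T}"
    by (auto simp: k_runs_def is_k_run_def k_repetition_def)
qed simp

end

theory Submission
  imports Defs "HOL-Library.Discrete_Functions"
begin

text \<open>Group the starts \<open>(p, l)\<close> of \<open>k\<close>-runs into blocks, where \<open>p\<close> ranges over an interval of length
  \<open>m = 2 ^ j\<close> and \<open>2 * m \<le> l < 4 * m\<close>.  A period has at most \<open>k + 1\<close> starts in a block.  Blocks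
  with \<open>O(k)\<close> periods contribute \<open>O(n * k)\<close> for each of the \<open>O(log k)\<close> scales with
  \<open>m = O(k)\<close>, and a geometrically decreasing amount for larger \<open>m\<close>.

  In a block with more periods, let \<open>d\<close> be the smallest difference of two of them; there are
  \<open>O(m / d)\<close> periods.  Nearby, \<open>T\<close> has \<open>O(k)\<close> mismatches with its shift by \<open>d\<close> over a length \<open>m\<close>,
  so a constant fraction of that fragment is covered by exact maximal \<open>d\<close>-periodic fragments of
  length \<open>\<Omega>(m / k)\<close>, each having an endpoint at distance \<open>O(m)\<close>.  The block is charged to them.
  A maximal fragment \<open>R\<close> of minimal period \<open>q\<close> is charged by \<open>O(1)\<close> blocks per scale, with
  \<open>O(k * min |R| m / q)\<close> each, and only for \<open>m = O(k * |R|)\<close>, which totals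
  \<open>O(k * log k * |R| / q)\<close>.  Finally \<open>\<Sum>|R| / q = O(n)\<close>, since maximal fragments with
  periods in the same dyadic range barely overlap.\<close>

section \<open>Starts of runs\<close>

definition mismatches :: "'a list \<Rightarrow> nat \<Rightarrow> nat \<Rightarrow> nat set" where
  "mismatches T l p = {i \<in> {p..<p + l}. T ! i \<noteq> T ! (i + l)}"

lemma finite_mismatches [simp]: "finite (mismatches T l p)"
  by (simp add: mismatches_def)

text \<open>A list of length \<open>2 * l\<close> splits into two halves in only one way, which
  settles the existential. The shift \<open>i - 1\<close> passes from 1-based starts to list
  indices.\<close>

lemma mismatch_square_iff:
  assumes "1 \<le> i" "i - 1 + 2 * l \<le> length T"
  shows "mismatch_square k (substr T i (i + 2 * l)) \<longleftrightarrow> card (mismatches T l (i - 1)) \<le> k"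
proof -
  define p where "p = i - 1"
  define X where "X = take l (drop p T)"
  define Y where "Y = take l (drop (p + l) T)"
  have len: "length X = l" "length Y = l"
    using assms by (auto simp: X_def Y_def p_def)
  have S: "substr T i (i + 2 * l) = X @ Y"
    using take_add [of l l "drop p T"]
    by (simp add: substr_def X_def Y_def p_def mult_2 add.commute)
  have sq: "mismatch_square k (X @ Y) \<longleftrightarrow> hamming_dist X Y \<le> k"
  proof
    assume "mismatch_square k (X @ Y)"
    then obtain X' Y' where XY: "X @ Y = X' @ Y'" "length X' = length Y'" "hamming_dist X' Y' \<le> k"
      unfolding mismatch_square_def by blast
    from XY(1,2) len have "length X' = l"
      by (metis add_left_imp_eq length_append mult_2 mult_cancel1 numeral_eq_iff zero_neq_numeral)
    with XY len have "X = X'" "Y = Y'"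
      by auto
    with XY show "hamming_dist X Y \<le> k" by simp
  next
    assume "hamming_dist X Y \<le> k"
    with len show "mismatch_square k (X @ Y)"
      unfolding mismatch_square_def by metis
  qed
  have "mismatches T l p = (\<lambda>i. p + i) ` {i. i < length X \<and> X ! i \<noteq> Y ! i}"
    (is "_ = _ ` ?M")
  proof (intro set_eqI iffI)
    fix r assume "r \<in> mismatches T l p"
    then have "r - p \<in> ?M" "r = p + (r - p)"
      using assms len by (auto simp: mismatches_def X_def Y_def p_def add.commute)
    then show "r \<in> (\<lambda>i. p + i) ` ?M" by blast
  next
    fix r assume "r \<in> (\<lambda>i. p + i) ` ?M"
    then show "r \<in> mismatches T l p"
      using assms len by (auto simp: mismatches_def X_def Y_def p_def ac_simps)
  qed
  then have "card (mismatches T l p) = hamming_dist X Y"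
    by (simp add: hamming_dist_def card_image)
  with S sq show ?thesis by (simp add: p_def)
qed

text \<open>A pair \<open>(p, l)\<close> such that a \<open>k\<close>-run of period \<open>l\<close> begins immediately after the
  0-based position \<open>p\<close>.\<close>

definition run_starts :: "nat \<Rightarrow> 'a list \<Rightarrow> (nat \<times> nat) set" where
  "run_starts k T = {(p, l). 1 \<le> l \<and> p + 1 + 2 * l \<le> length T \<and>
     T ! p \<noteq> T ! (p + l) \<and> card (mismatches T l p) = k + 1}"

lemma finite_run_starts [simp]: "finite (run_starts k T)"
  by (rule finite_subset [of _ "{..length T} \<times> {..length T}"]) (auto simp: run_starts_def)

lemma k_repetition_iff:
  "k_repetition k T a b l \<longleftrightarrow>
     1 \<le> a \<and> b \<le> length T + 1 \<and> a + 2 * l \<le> b \<and>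
     (\<forall>i\<in>{a..b - 2 * l}. card (mismatches T l (i - 1)) \<le> k)"
proof -
  have "mismatch_square k (substr T i (i + 2 * l)) \<longleftrightarrow> card (mismatches T l (i - 1)) \<le> k"
    if "1 \<le> a" "b \<le> length T + 1" "a + 2 * l \<le> b" "i \<in> {a..b - 2 * l}" for i
    using that by (intro mismatch_square_iff) auto
  then show ?thesis
    unfolding k_repetition_def by (metis (no_types, lifting))
qed

text \<open>By maximality to the left, the window at \<open>p\<close> has more than \<open>k\<close>
  mismatches, while the next one, where the run starts, has at most \<open>k\<close>. Only position
  \<open>p\<close> is lost between them, so it is a mismatch and the count is exactly
  \<open>k + 1\<close>. The 1-based start \<open>p + 2\<close> is the list index
  \<open>p + 1\<close>.\<close>

lemma k_run_start:
  assumes "is_k_run k T (p + 2) b l" "1 \<le> l"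
  shows "(p, l) \<in> run_starts k T"
proof -
  have rep: "k_repetition k T (p + 2) b l"
    and maxi: "\<And>a' b'. a' \<le> p + 2 \<Longrightarrow> b \<le> b' \<Longrightarrow> k_repetition k T a' b' l \<Longrightarrow> a' = p + 2"
    using assms unfolding is_k_run_def by blast+
  have b: "b \<le> length T + 1" "p + 2 + 2 * l \<le> b"
    using rep by (auto simp: k_repetition_iff)
  have le: "card (mismatches T l (i - 1)) \<le> k" if "i \<in> {p + 2..b - 2 * l}" for i
    using rep that by (auto simp: k_repetition_iff)
  have gt: "card (mismatches T l p) > k"
  proof (rule ccontr)
    assume "\<not> ?thesis"
    then have "card (mismatches T l (i - 1)) \<le> k" if "i \<in> {p + 1..b - 2 * l}" for i
      using that le [of i] by (cases "i = p + 1") auto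
    then have "k_repetition k T (p + 1) b l"
      using b by (auto simp: k_repetition_iff)
    from maxi [OF _ _ this] show False by auto
  qed
  have le': "card (mismatches T l (p + 1)) \<le> k"
    using le [of "p + 2"] b by auto
  have sub: "mismatches T l p \<subseteq> (if T ! p \<noteq> T ! (p + l) then {p} else {}) \<union> mismatches T l (p + 1)"
    (is "_ \<subseteq> ?A \<union> _")
  proof
    fix i assume "i \<in> mismatches T l p"
    then show "i \<in> ?A \<union> mismatches T l (p + 1)"
      by (cases "i = p") (auto simp: mismatches_def)
  qed
  have neq: "T ! p \<noteq> T ! (p + l)"
  proof
    assume "T ! p = T ! (p + l)"
    with sub have "mismatches T l p \<subseteq> mismatches T l (p + 1)" by simp
    from card_mono [OF _ this] gt le' show False by simp
  qed
  with sub have "mismatches T l p \<subseteq> insert p (mismatches T l (p + 1))" by simp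
  from card_mono [OF _ this] have "card (mismatches T l p) \<le> k + 1"
    using le' card_insert_le_m1 [of "k + 1" "mismatches T l (p + 1)" p]
    by (simp add: card_insert_if split: if_splits)
  with gt neq b assms show ?thesis
    by (auto simp: run_starts_def)
qed

text \<open>Two runs with equal \<open>a\<close> and \<open>l\<close> are nested, so maximality
  makes \<open>(a, l)\<close> identify a run. A run with \<open>a = 1\<close> has no position before
  it; there is at most one per period.\<close>

lemma card_k_runs_le: "card (k_runs k T) \<le> length T + card (run_starts k T)"
proof -
  define g :: "nat \<times> nat \<times> nat \<Rightarrow> nat \<times> nat" where "g = (\<lambda>(a, b, l). (a, l))"
  have eq: "b = b'" if "is_k_run k T a b l" "is_k_run k T a b' l" for a b b' l
    using that unfolding is_k_run_def by (metis le_refl linear)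
  have "inj_on g (k_runs k T)"
    by (rule inj_onI) (auto simp: g_def k_runs_def intro: eq)
  then have "card (k_runs k T) = card (g ` k_runs k T)"
    by (simp add: card_image)
  also have "\<dots> \<le> card ({1} \<times> {1..length T} \<union> (\<lambda>(p, l). (p + 2, l)) ` run_starts k T)"
  proof (rule card_mono)
    show "g ` k_runs k T \<subseteq> {1} \<times> {1..length T} \<union> (\<lambda>(p, l). (p + 2, l)) ` run_starts k T"
    proof
      fix z assume "z \<in> g ` k_runs k T"
      then obtain a b l where z: "z = (a, l)" and l: "1 \<le> l" "l \<le> length T div 2"
        and run: "is_k_run k T a b l"
        by (auto simp: g_def k_runs_def)
      have a: "1 \<le> a"
        using run by (auto simp: is_k_run_def k_repetition_def)
      show "z \<in> {1} \<times> {1..length T} \<union> (\<lambda>(p, l). (p + 2, l)) ` run_starts k T"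
      proof (cases "a = 1")
        case True
        with l z show ?thesis by auto
      next
        case False
        with a obtain p where p: "a = p + 2"
          by (metis add.commute le_antisym less_eqE not_less_eq_eq one_add_one plus_1_eq_Suc add_Suc)
        from k_run_start [of k T p b l] run l p z show ?thesis by force
      qed
    qed
  qed auto
  also have "\<dots> \<le> length T + card (run_starts k T)"
    by (rule order.trans [OF card_Un_le])
       (auto simp: card_cartesian_product intro: card_image_le)
  finally show ?thesis .
qed

section \<open>Maximal periodic fragments\<close>

definition periodic_on :: "'a list \<Rightarrow> nat \<Rightarrow> nat \<Rightarrow> nat \<Rightarrow> bool" where
  "periodic_on T d s e \<longleftrightarrow>
     e \<le> length T \<and> (\<forall>i. s \<le> i \<and> i + d < e \<longrightarrow> T ! i = T ! (i + d))"

definition maximal_periodic :: "'a list \<Rightarrow> nat \<Rightarrow> nat \<Rightarrow> nat \<Rightarrow> bool" where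
  "maximal_periodic T d s e \<longleftrightarrow> periodic_on T d s e \<and>
     (\<forall>s' e'. s' \<le> s \<and> e \<le> e' \<and> periodic_on T d s' e' \<longrightarrow> s' = s \<and> e' = e)"

lemma ex_maximal_periodic:
  assumes "periodic_on T d s e"
  obtains s' e' where "s' \<le> s" "e \<le> e'" "maximal_periodic T d s' e'"
proof -
  let ?P = "\<lambda>z. fst z \<le> s \<and> e \<le> snd z \<and> periodic_on T d (fst z) (snd z)"
  \<comment> \<open>Any proper extension, to either side, increases this bounded quantity.\<close>
  let ?f = "\<lambda>z. snd z + (s - fst z)"
  have "?P (s, e)" using assms by simp
  moreover have "\<forall>z. ?P z \<longrightarrow> ?f z < length T + s + 1"
    by (auto simp: periodic_on_def)
  ultimately obtain z where z: "?P z" and maxi: "\<And>y. ?P y \<Longrightarrow> ?f y \<le> ?f z"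
    using ex_has_greatest_nat [of ?P _ ?f] by blast
  have "maximal_periodic T d (fst z) (snd z)"
    unfolding maximal_periodic_def
  proof (intro conjI allI impI; (elim conjE)?)
    show "periodic_on T d (fst z) (snd z)" using z by simp
  next
    fix s' e' assume *: "s' \<le> fst z" "snd z \<le> e'" "periodic_on T d s' e'"
    with z maxi [of "(s', e')"] have "e' + (s - s') \<le> snd z + (s - fst z)" by simp
    with * z show "s' = fst z" "e' = snd z" by auto
  qed
  with z that show thesis by blast
qed

text \<open>The positions \<open>i\<close>, \<open>i + q\<close>, \<open>i + q'\<close>,
  \<open>i + q + q'\<close> form a square. With its last or first corner just outside the first
  fragment, three sides are known equalities and yield the fourth, which is the extension.\<close>

lemma periodic_on_overlap_extends:
  assumes "periodic_on T q s e" "periodic_on T q' s' e'" "1 \<le> q" "1 \<le> q'"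
    and "s \<le> y" "s' \<le> y" "y + q + q' \<le> e" "y + q + q' \<le> e'"
  shows "e < e' \<Longrightarrow> periodic_on T q s (e + 1)" and "s' < s \<Longrightarrow> periodic_on T q (s - 1) e"
proof -
  have R: "T ! i = T ! (i + q)" if "s \<le> i" "i + q < e" for i
    using assms(1) that by (auto simp: periodic_on_def)
  have R': "T ! i = T ! (i + q')" if "s' \<le> i" "i + q' < e'" for i
    using assms(2) that by (auto simp: periodic_on_def)
  show "periodic_on T q s (e + 1)" if "e < e'"
  proof -
    define i where "i = e - q - q'"
    have i: "e = i + q + q'" "y \<le> i"
      using assms by (auto simp: i_def)
    have "T ! (i + q') = T ! e"
      using R [of i] R' [of i] R' [of "i + q"] R [of "i + q'"] assms i that
      by (simp add: ac_simps)
    then have "T ! r = T ! (r + q)" if "s \<le> r" "r + q < e + 1" for r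
      using R [of r] that i
      by (cases "r + q = e") (auto simp: ac_simps)
    then show ?thesis
      using assms that by (auto simp: periodic_on_def)
  qed
  show "periodic_on T q (s - 1) e" if "s' < s"
  proof -
    define i where "i = s - 1"
    have i: "s = i + 1" using that by (simp add: i_def)
    have "T ! i = T ! (i + q)"
      using R [of "i + q'"] R' [of i] R' [of "i + q"] assms i that
      by (simp add: ac_simps)
    then have "T ! r = T ! (r + q)" if "s - 1 \<le> r" "r + q < e" for r
      using R [of r] that i
      by (cases "r = i") auto
    then show ?thesis
      using assms that by (auto simp: periodic_on_def)
  qed
qed

lemma maximal_periodic_overlap:
  assumes R: "maximal_periodic T q s e" and R': "maximal_periodic T q' s' e'"
    and q: "1 \<le> q" "1 \<le> q'"
    and y: "s \<le> y" "s' \<le> y" "y + q + q' \<le> e" "y + q + q' \<le> e'"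
  shows "s = s' \<and> e = e'"
proof -
  have p: "periodic_on T q s e" "periodic_on T q' s' e'"
    using R R' by (auto simp: maximal_periodic_def)
  have m: "b \<le> e" if "periodic_on T q s b" for b
    using R that unfolding maximal_periodic_def by (metis le_refl linear)
  have m': "b \<le> e'" if "periodic_on T q' s' b" for b
    using R' that unfolding maximal_periodic_def by (metis le_refl linear)
  have l: "s \<le> a" if "periodic_on T q a e" for a
    using R that unfolding maximal_periodic_def by (metis le_refl linear)
  have l': "s' \<le> a" if "periodic_on T q' a e'" for a
    using R' that unfolding maximal_periodic_def by (metis le_refl linear)
  note ext = periodic_on_overlap_extends [OF p q y]
  note ext' = periodic_on_overlap_extends [OF p(2,1) q(2,1) y(2,1)]
  have "\<not> e < e'" "\<not> s' < s"
    using m [OF ext(1)] l [OF ext(2)] by auto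
  moreover have "\<not> e' < e" "\<not> s < s'"
    using m' [OF ext'(1)] l' [OF ext'(2)] y by auto
  ultimately show ?thesis by simp
qed

section \<open>Exponents of long maximal fragments\<close>

text \<open>With six periods, at least half of the fragment remains after three of them are trimmed
  off.\<close>

definition long_period :: "'a list \<Rightarrow> nat \<Rightarrow> nat \<Rightarrow> nat \<Rightarrow> bool" where
  "long_period T s e d \<longleftrightarrow> 1 \<le> d \<and> maximal_periodic T d s e \<and> s + 6 * d \<le> e"

text \<open>The period is left out so that a fragment that is maximal for several periods is counted
  only once.\<close>

definition long_runs :: "'a list \<Rightarrow> (nat \<times> nat) set" where
  "long_runs T = {(s, e). \<exists>d. long_period T s e d}"

definition min_period :: "'a list \<Rightarrow> nat \<Rightarrow> nat \<Rightarrow> nat" where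
  "min_period T s e = (LEAST d. long_period T s e d)"

lemma long_period_min_period:
  "(s, e) \<in> long_runs T \<Longrightarrow> long_period T s e (min_period T s e)"
  by (auto simp: long_runs_def min_period_def intro: LeastI)

lemma min_period_le: "long_period T s e d \<Longrightarrow> min_period T s e \<le> d"
  by (simp add: min_period_def Least_le)

lemma long_runs_subset: "long_runs T \<subseteq> {..length T} \<times> {..length T}"
  by (auto simp: long_runs_def long_period_def maximal_periodic_def periodic_on_def)

lemma finite_long_runs [simp]: "finite (long_runs T)"
  by (rule finite_subset [OF long_runs_subset]) simp

text \<open>Two distinct long runs whose periods lie in the same dyadic range overlap in less than the
  sum of their periods, so after trimming three periods off the right end they are disjoint.\<close>

lemma sum_inverse_periods_at_position:
  fixes T :: "'a list"
  defines "q \<equiv> \<lambda>R. min_period T (fst R) (snd R)"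
  shows "(\<Sum>R | R \<in> long_runs T \<and> fst R \<le> y \<and> y + 3 * q R < snd R. 1 / real (q R)) \<le> 2"
proof -
  let ?A = "{R. R \<in> long_runs T \<and> fst R \<le> y \<and> y + 3 * q R < snd R}"
  have fin: "finite ?A"
    by (rule finite_subset [of _ "long_runs T"]) auto
  have q: "long_period T (fst R) (snd R) (q R)" if "R \<in> ?A" for R
    using that long_period_min_period [of "fst R" "snd R" T] by (simp add: q_def)
  have inj: "inj_on (\<lambda>R. floor_log (q R)) ?A"
  proof (rule inj_onI)
    fix R R' assume R: "R \<in> ?A" and R': "R' \<in> ?A" and eq: "floor_log (q R) = floor_log (q R')"
    have pos: "1 \<le> q R" "1 \<le> q R'"
      using q [OF R] q [OF R'] by (auto simp: long_period_def)
    \<comment> \<open>Each period is less than twice the other, so \<open>q R + q R'\<close> is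
      below both \<open>3 * q R\<close> and \<open>3 * q R'\<close>, and both fragments reach that
      far to the right of \<open>y\<close>.\<close>
    have "q R < 2 * q R'"
      using floor_log_exp2_gt [of "q R"] floor_log_exp2_le [of "q R'"] pos eq by simp
    moreover have "q R' < 2 * q R"
      using floor_log_exp2_gt [of "q R'"] floor_log_exp2_le [of "q R"] pos eq by simp
    ultimately show "R = R'"
      using maximal_periodic_overlap [of T "q R" "fst R" "snd R" "q R'" "fst R'" "snd R'" y]
        q [OF R] q [OF R'] R R' pos
      by (auto simp: long_period_def prod_eq_iff)
  qed
  have "(\<Sum>R\<in>?A. 1 / real (q R)) \<le> (\<Sum>R\<in>?A. (1 / 2) ^ floor_log (q R))"
  proof (rule sum_mono)
    fix R assume "R \<in> ?A"
    then have "1 \<le> q R" using q by (auto simp: long_period_def)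
    then have "2 ^ floor_log (q R) \<le> q R"
      by (intro floor_log_exp2_le) auto
    then have "real (2 ^ floor_log (q R)) \<le> real (q R)"
      by (simp only: of_nat_le_iff)
    then show "1 / real (q R) \<le> (1 / 2) ^ floor_log (q R)"
      by (simp add: power_one_over frac_le)
  qed
  also have "\<dots> = (\<Sum>j\<in>(\<lambda>R. floor_log (q R)) ` ?A. (1 / 2) ^ j)"
    using sum.reindex [OF inj, of "\<lambda>j. (1 / 2 :: real) ^ j"] by simp
  also have "\<dots> \<le> (\<Sum>j. (1 / 2) ^ j)"
    by (rule sum_le_suminf) (use fin in \<open>auto simp: summable_geometric\<close>)
  also have "\<dots> = (2 :: real)"
    by (simp add: suminf_geometric)
  finally show ?thesis .
qed

text \<open>Double counting: the trimmed fragment keeps at least half of the length, and each of its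
  positions \<open>y\<close> receives \<open>1 / q\<close>. By the previous lemma a position
  receives at most 2 in total.\<close>

lemma sum_exponents_long_runs:
  fixes T :: "'a list"
  defines "q \<equiv> \<lambda>R. min_period T (fst R) (snd R)"
  shows "(\<Sum>R\<in>long_runs T. real (snd R - fst R) / real (q R)) \<le> 4 * real (length T)"
proof -
  let ?c = "\<lambda>R y. fst R \<le> y \<and> y + 3 * q R < snd R"
  have "(\<Sum>R\<in>long_runs T. real (snd R - fst R) / real (q R))
      \<le> (\<Sum>R\<in>long_runs T. 2 * (\<Sum>y | y \<in> {..<length T} \<and> ?c R y. 1 / real (q R)))"
  proof (rule sum_mono)
    fix R assume "R \<in> long_runs T"
    then have R: "long_period T (fst R) (snd R) (q R)"
      using long_period_min_period [of "fst R" "snd R" T] by (simp add: q_def)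
    then have e: "snd R \<le> length T"
      by (auto simp: long_period_def maximal_periodic_def periodic_on_def)
    then have "{y. y \<in> {..<length T} \<and> ?c R y} = {fst R..<snd R - 3 * q R}"
      by auto
    moreover have "snd R - fst R \<le> 2 * (snd R - 3 * q R - fst R)"
      using R by (auto simp: long_period_def)
    then have "real (snd R - fst R) \<le> real (2 * (snd R - 3 * q R - fst R))"
      by (simp only: of_nat_le_iff)
    ultimately show "real (snd R - fst R) / real (q R)
        \<le> 2 * (\<Sum>y | y \<in> {..<length T} \<and> ?c R y. 1 / real (q R))"
      by (simp add: divide_right_mono)
  qed
  also have "\<dots> = 2 * (\<Sum>y<length T. \<Sum>R | R \<in> long_runs T \<and> ?c R y. 1 / real (q R))"
    unfolding sum_distrib_left [symmetric] by (subst sum.swap_restrict) auto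
  also have "\<dots> \<le> 2 * (\<Sum>y<length T. 2)"
    unfolding q_def by (intro mult_left_mono sum_mono sum_inverse_periods_at_position) auto
  finally show ?thesis by simp
qed

section \<open>Blocks of run starts\<close>

text \<open>For the least positive difference \<open>d\<close>, every cell of length
  \<open>d\<close> contains at most one element of \<open>A\<close>, and at most
  \<open>N div d + 1\<close> cells meet the interval.\<close>

lemma close_pair_in_interval:
  fixes A :: "nat set"
  assumes A: "A \<subseteq> {a..<a + N}" and card: "2 \<le> card A"
  obtains l d where "l \<in> A" "l + d \<in> A" "1 \<le> d" "(card A - 1) * d \<le> N"
proof -
  have fin: "finite A"
    using A finite_subset by blast
  let ?P = "\<lambda>d. 1 \<le> d \<and> (\<exists>l\<in>A. l + d \<in> A)"
  have "\<not> is_singleton A" "A \<noteq> {}"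
    using card by (auto simp: is_singleton_altdef)
  then obtain x y where "x \<in> A" "y \<in> A" "x < y"
    by (metis is_singletonI' linorder_neqE_nat)
  then have "?P (y - x)" by (intro conjI bexI [of _ x]) auto
  define d where "d = (LEAST d. ?P d)"
  have d: "?P d"
    unfolding d_def by (rule LeastI) fact
  have least: "d \<le> d'" if "?P d'" for d'
    unfolding d_def using that by (rule Least_le)
  have gap: "\<not> y < x + d" if "x \<in> A" "y \<in> A" "x < y" for x y
    using least [of "y - x"] that by force
  have "inj_on (\<lambda>l. (l - a) div d) A"
  proof (rule inj_onI, rule ccontr)
    fix x y assume xy: "x \<in> A" "y \<in> A" "(x - a) div d = (y - a) div d" "x \<noteq> y"
    have *: "(x - a) mod d < d" "(y - a) mod d < d"
      using d by auto
    have "x - a = (y - a) div d * d + (x - a) mod d" "y - a = (y - a) div d * d + (y - a) mod d"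
      using xy(3) by (metis div_mult_mod_eq)+
    with * have "x - a < y - a + d" "y - a < x - a + d"
      by linarith+
    moreover have "a \<le> x" "a \<le> y" using xy A by auto
    ultimately show False
      using gap [of x y] gap [of y x] xy by linarith
  qed
  then have "card A = card ((\<lambda>l. (l - a) div d) ` A)"
    by (simp add: card_image)
  also have "\<dots> \<le> card {..N div d}"
  proof (rule card_mono)
    show "(\<lambda>l. (l - a) div d) ` A \<subseteq> {..N div d}"
      using A by (force intro!: div_le_mono)
  qed simp
  finally have "card A - 1 \<le> N div d" by simp
  then have "(card A - 1) * d \<le> N div d * d" by simp
  also have "\<dots> \<le> N" by simp
  finally show thesis using that d by blast
qed

text \<open>Cut the interval into \<open>c\<close> cells of length \<open>h\<close>. Each element of
  \<open>E\<close> spoils one cell at most; \<open>Y\<close> is the union of the others.\<close>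

lemma many_clean_cells:
  fixes E :: "nat set"
  assumes E: "finite E" and h: "1 \<le> h"
  obtains Y where "Y \<subseteq> {v..<v + c * h}" "(c - card E) * h \<le> card Y"
    "\<And>y. y \<in> Y \<Longrightarrow> \<exists>u. v \<le> u \<and> u \<le> y \<and> y < u + h \<and> u + h \<le> v + c * h \<and> {u..<u + h} \<inter> E = {}"
proof
  let ?f = "\<lambda>y. (y - v) div h"
  \<comment> \<open>Truncated subtraction sends elements of \<open>E\<close> left of
    \<open>v\<close> to cell 0; still at most \<open>card E\<close> cells are discarded.\<close>
  define Y where "Y = {y \<in> {v..<v + c * h}. ?f y \<notin> ?f ` E}"
  show "Y \<subseteq> {v..<v + c * h}" by (auto simp: Y_def)
  have fY: "finite Y" by (simp add: Y_def)
  have cell: "v + ?f y * h \<le> y \<and> y < v + ?f y * h + h" if "v \<le> y" for y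
  proof -
    have "y - v = ?f y * h + (y - v) mod h" "(y - v) mod h < h"
      using h by auto
    with that show ?thesis by linarith
  qed
  have "{v..<v + c * h} \<subseteq> Y \<union> (\<Union>r\<in>?f ` E. {v + r * h..<v + r * h + h})"
  proof
    fix y assume "y \<in> {v..<v + c * h}"
    with cell [of y] show "y \<in> Y \<union> (\<Union>r\<in>?f ` E. {v + r * h..<v + r * h + h})"
      by (cases "?f y \<in> ?f ` E") (auto simp: Y_def)
  qed
  then have "card {v..<v + c * h} \<le> card (Y \<union> (\<Union>r\<in>?f ` E. {v + r * h..<v + r * h + h}))"
    using E fY by (intro card_mono) auto
  also have "\<dots> \<le> card Y + card (\<Union>r\<in>?f ` E. {v + r * h..<v + r * h + h})"
    by (rule card_Un_le)
  also have "card (\<Union>r\<in>?f ` E. {v + r * h..<v + r * h + h}) \<le> (\<Sum>r\<in>?f ` E. h)"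
    using E by (intro order.trans [OF card_UN_le]) auto
  also have "\<dots> \<le> card E * h"
    using card_image_le [OF E, of ?f] by simp
  finally show "(c - card E) * h \<le> card Y"
    by (simp add: diff_mult_distrib)
  fix y assume y: "y \<in> Y"
  define u where "u = v + ?f y * h"
  have "?f y < c"
    using y h by (auto simp: Y_def less_mult_imp_div_less)
  then have "(?f y + 1) * h \<le> c * h"
    by (intro mult_le_mono1) simp
  then have "u + h \<le> v + c * h" by (simp add: u_def)
  moreover have "u \<le> y \<and> y < u + h"
    using cell [of y] y by (simp add: u_def Y_def)
  moreover have "{u..<u + h} \<inter> E = {}"
  proof (rule ccontr)
    assume "\<not> ?thesis"
    then obtain z where z: "z \<in> E" "u \<le> z" "z < u + h" by auto
    then have "z - v = ?f y * h + (z - u)" "z - u < h"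
      by (auto simp: u_def)
    then have "?f z = ?f y"
      using h by (simp only: div_mult_self3 div_less)
    with z have "?f y \<in> ?f ` E" by (metis imageI)
    with y show False by (simp add: Y_def)
  qed
  moreover have "v \<le> u" by (simp add: u_def)
  ultimately show "\<exists>u. v \<le> u \<and> u \<le> y \<and> y < u + h \<and> u + h \<le> v + c * h \<and> {u..<u + h} \<inter> E = {}"
    by blast
qed

lemma periodic_on_iterate:
  assumes "periodic_on T d s e" "s \<le> i" "i + d * r < e"
  shows "T ! (i + d * r) = T ! i"
  using assms(3)
proof (induction r)
  case (Suc r)
  have "T ! (i + d * r) = T ! (i + d * r + d)"
    using assms(1,2) Suc.prems by (auto simp: periodic_on_def ac_simps)
  with Suc show ?case by (simp add: ac_simps)
qed simp

text \<open>Inside a \<open>d\<close>-periodic fragment every mismatch repeats with period \<open>d\<close>.\<close>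

lemma periodic_many_mismatches:
  assumes per: "periodic_on T d p (p + 2 * l)" and d: "1 \<le> d" and neq: "T ! p \<noteq> T ! (p + l)"
  shows "l \<le> d * card (mismatches T l p)"
proof (rule ccontr)
  let ?c = "card (mismatches T l p)"
  assume "\<not> ?thesis"
  then have c: "d * ?c < l" by simp
  \<comment> \<open>The mismatch at \<open>p\<close> is copied to \<open>?c + 1\<close> positions of
    the window, one more than it has.\<close>
  have "(\<lambda>r. p + d * r) ` {..?c} \<subseteq> mismatches T l p"
  proof clarify
    fix r assume "r \<le> ?c"
    then have r: "d * r < l"
      using c by (meson le_less_trans mult_le_mono2)
    have "T ! (p + d * r) = T ! p" "T ! (p + l + d * r) = T ! (p + l)"
      using r by (intro periodic_on_iterate [OF per]; simp)+
    with neq r show "p + d * r \<in> mismatches T l p"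
      by (simp add: mismatches_def ac_simps)
  qed
  moreover have "inj_on (\<lambda>r. p + d * r) {..?c}"
    using d by (auto simp: inj_on_def)
  ultimately have "card {..?c} \<le> ?c"
    by (metis card_image card_mono finite_mismatches)
  then show False by simp
qed

text \<open>Periods are at least twice the block length, so the window of any start covers the rest
  of its block and the whole next one.\<close>

definition block :: "nat \<Rightarrow> 'a list \<Rightarrow> nat \<Rightarrow> nat \<Rightarrow> (nat \<times> nat) set" where
  "block k T j t =
     {(p, l) \<in> run_starts k T. 2 * 2 ^ j \<le> l \<and> l < 4 * 2 ^ j \<and> p div 2 ^ j = t}"

lemma finite_block [simp]: "finite (block k T j t)"
  by (rule finite_subset [of _ "run_starts k T"]) (auto simp: block_def)

lemma block_position:
  "(p, l) \<in> block k T j t \<Longrightarrow> 2 ^ j * t \<le> p \<and> p < 2 ^ j * t + 2 ^ j"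
  using mult_div_mod_eq [of "2 ^ j" p] mod_less_divisor [of "2 ^ j" p]
  by (auto simp: block_def simp del: mod_less_divisor mult_div_mod_eq)

text \<open>Every run start of period \<open>l\<close> in the block is a mismatch in the window of the leftmost one.\<close>

lemma card_block_le: "card (block k T j t) \<le> (k + 1) * card (snd ` block k T j t)"
proof -
  let ?F = "\<lambda>l. {p. (p, l) \<in> block k T j t}"
  have finF: "finite (?F l)" for l
    by (rule finite_subset [of _ "fst ` block k T j t"]) force+
  have "card (?F l) \<le> k + 1" for l
  proof (cases "?F l = {}")
    case False
    define p where "p = Min (?F l)"
    have p: "(p, l) \<in> block k T j t"
      using Min_in [OF finF False] by (simp add: p_def)
    have "?F l \<subseteq> mismatches T l p"
    proof
      fix r assume r: "r \<in> ?F l"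
      then have "p \<le> r" unfolding p_def using finF by (intro Min_le) auto
      moreover have "r < p + l"
        using block_position [OF p] block_position [of r l k T j t] p r
        by (auto simp: block_def)
      ultimately show "r \<in> mismatches T l p"
        using r by (auto simp: mismatches_def block_def run_starts_def)
    qed
    then have "card (?F l) \<le> card (mismatches T l p)"
      by (intro card_mono) auto
    with p show ?thesis by (auto simp: block_def run_starts_def)
  next
    case True
    then show ?thesis by (simp only: card.empty)
  qed
  then have "(\<Sum>l\<in>snd ` block k T j t. card (?F l)) \<le> (\<Sum>l\<in>snd ` block k T j t. k + 1)"
    by (intro sum_mono)
  moreover have "card (block k T j t) \<le> card (Sigma (snd ` block k T j t) ?F)"
  proof -
    have "block k T j t \<subseteq> (\<lambda>(l, p). (p, l)) ` Sigma (snd ` block k T j t) ?F"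
      by force
    then have "card (block k T j t) \<le> card ((\<lambda>(l, p). (p, l)) ` Sigma (snd ` block k T j t) ?F)"
      using finF by (intro card_mono) auto
    also have "\<dots> \<le> card (Sigma (snd ` block k T j t) ?F)"
      using finF by (intro card_image_le) auto
    finally show ?thesis .
  qed
  moreover have "card (Sigma (snd ` block k T j t) ?F) = (\<Sum>l\<in>snd ` block k T j t. card (?F l))"
    using finF by (intro card_SigmaI) auto
  ultimately show ?thesis
    by (simp add: mult.commute)
qed

lemma block_periods_subset: "snd ` block k T j t \<subseteq> {2 * 2 ^ j..<2 * 2 ^ j + 2 * 2 ^ j}"
  by (auto simp: block_def)

lemma card_block_periods_le: "card (snd ` block k T j t) \<le> 2 * 2 ^ j"
  using card_mono [OF _ block_periods_subset [of k T j t]] by simp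

text \<open>For a fragment with endpoints \<open>s\<close> and \<open>e\<close>: the first condition
  bounds the scale in terms of its length, and the second puts an endpoint into one of ten
  consecutive blocks, so at most 20 blocks per scale charge it.\<close>

definition charges :: "nat \<Rightarrow> nat \<Rightarrow> nat \<Rightarrow> nat \<Rightarrow> nat \<Rightarrow> bool" where
  "charges k j t s e \<longleftrightarrow> 2 ^ j \<le> 4 * (k + 1) * (e - s) \<and>
     (t \<le> s div 2 ^ j \<and> s div 2 ^ j \<le> t + 9 \<or> t \<le> e div 2 ^ j \<and> e div 2 ^ j \<le> t + 9)"

text \<open>Two close periods \<open>l1 < l1 + d\<close> of the block give a fragment of length \<open>2 ^ j\<close> with at most
  \<open>2 * (k + 1)\<close> mismatches with respect to \<open>d\<close>.  A maximal \<open>d\<close>-periodic fragment cannot cover the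
  whole square of a run start, since that square has too few mismatches.\<close>

lemma dense_block:
  assumes dense: "65 * (k + 1) < card (snd ` block k T j t)"
  obtains d Y where "1 \<le> d" "card (snd ` block k T j t) * d \<le> 4 * 2 ^ j"
    "Y \<subseteq> {2 ^ j * (t + 3)..<2 ^ j * (t + 6)}" "2 ^ j \<le> 4 * card Y"
    "\<And>y. y \<in> Y \<Longrightarrow> \<exists>s e. long_period T s e d \<and> s \<le> y \<and> y < e \<and> charges k j t s e"
proof -
  define m :: nat where "m = 2 ^ j"
  define x where "x = m * t"
  let ?A = "snd ` block k T j t"
  have "2 \<le> card ?A" using dense by simp
  with block_periods_subset obtain l1 d where l: "l1 \<in> ?A" "l1 + d \<in> ?A" and d: "1 \<le> d"
    and card: "(card ?A - 1) * d \<le> 2 * m"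
    unfolding m_def by (rule close_pair_in_interval)
  define l2 where "l2 = l1 + d"
  obtain p1 where p1: "(p1, l1) \<in> block k T j t" using l by auto
  obtain p2 where p2: "(p2, l2) \<in> block k T j t" using l by (auto simp: l2_def)
  have x1: "x \<le> p1" "p1 < x + m" and x2: "x \<le> p2" "p2 < x + m"
    using block_position [OF p1] block_position [OF p2] by (auto simp: x_def m_def)
  have l1: "2 * m \<le> l1" "l1 < 4 * m" and l2: "2 * m \<le> l2" "l2 < 4 * m"
    and s1: "(p1, l1) \<in> run_starts k T" and s2: "(p2, l2) \<in> run_starts k T"
    using p1 p2 by (auto simp: block_def m_def)
  have mm: "card (mismatches T l1 p1) = k + 1" "card (mismatches T l2 p2) = k + 1"
    "T ! p1 \<noteq> T ! (p1 + l1)" "p1 + 2 * l1 \<le> length T" "p2 + 2 * l2 \<le> length T"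
    using s1 s2 by (auto simp: run_starts_def)
  have "64 * (k + 1) + 1 \<le> card ?A - 1" using dense by simp
  then have "(64 * (k + 1) + 1) * d \<le> (card ?A - 1) * d"
    by (rule mult_le_mono1)
  \<comment> \<open>Density makes \<open>d\<close> at most
    \<open>m / (32 * (k + 1))\<close>.\<close>
  with card have dm: "64 * ((k + 1) * d) + d \<le> 2 * m"
    by (simp add: algebra_simps)
  have "card ?A * d = (card ?A - 1) * d + d"
    using \<open>2 \<le> card ?A\<close> by (simp add: diff_mult_distrib)
  with card dm have card_d: "card ?A * d \<le> 4 * m" by linarith
  \<comment> \<open>Positions \<open>i\<close> from \<open>x + m\<close> up to
    \<open>x + 2 * m\<close> lie in the windows of both starts. If neither has a mismatch at
    \<open>i\<close>, then \<open>T ! (i + l1) = T ! i = T ! (i + l1 + d)\<close>. Hence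
    \<open>E\<close> has at most as many elements as the two windows have mismatches.\<close>
  define v where "v = x + m + l1"
  define E where "E = {y \<in> {v..<v + m}. T ! y \<noteq> T ! (y + d)}"
  have "E \<subseteq> (\<lambda>i. i + l1) ` (mismatches T l1 p1 \<union> mismatches T l2 p2)"
  proof
    fix y assume y: "y \<in> E"
    define i where "i = y - l1"
    have i: "y = i + l1" "x + m \<le> i" "i < x + 2 * m"
      using y by (auto simp: E_def v_def i_def)
    have "i \<in> mismatches T l1 p1 \<union> mismatches T l2 p2"
      using y i x1 x2 l1 l2 by (auto simp: E_def mismatches_def l2_def ac_simps)
    with i show "y \<in> (\<lambda>i. i + l1) ` (mismatches T l1 p1 \<union> mismatches T l2 p2)" by blast
  qed
  then have "card E \<le> card (mismatches T l1 p1 \<union> mismatches T l2 p2)"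
    by (meson card_image_le card_mono finite_UnI finite_imageI finite_mismatches order.trans)
  also have "\<dots> \<le> 2 * (k + 1)"
    using card_Un_le [of "mismatches T l1 p1" "mismatches T l2 p2"] mm by simp
  finally have cardE: "card E \<le> 2 * (k + 1)" .
  \<comment> \<open>Twice the bound on \<open>card E\<close>, so at least half of the cells are
    clean; rounding in \<open>h\<close> costs another factor 2, hence
    \<open>m \<le> 4 * card Y\<close>.\<close>
  define c where "c = 4 * (k + 1)"
  define h where "h = m div c"
  have c: "1 \<le> c" by (simp add: c_def)
  have hd: "8 * d \<le> h"
    unfolding h_def using dm c
    by (subst less_eq_div_iff_mult_less_eq) (auto simp: c_def algebra_simps)
  have chm: "c * h \<le> m" by (simp add: h_def)
  have mch: "m < c * (h + 1)"
    using c by (simp add: h_def dividend_less_times_div)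
  have "finite E" by (simp add: E_def)
  moreover have "1 \<le> h" using hd d by simp
  ultimately obtain Y where Y: "Y \<subseteq> {v..<v + c * h}" "(c - card E) * h \<le> card Y"
    and cell: "\<And>y. y \<in> Y \<Longrightarrow>
      \<exists>u. v \<le> u \<and> u \<le> y \<and> y < u + h \<and> u + h \<le> v + c * h \<and> {u..<u + h} \<inter> E = {}"
    using many_clean_cells [of E h v c] by blast
  have "2 * (k + 1) * h \<le> (c - card E) * h"
    using cardE by (intro mult_le_mono1) (simp add: c_def)
  with Y have "2 * (k + 1) * h \<le> card Y" by simp
  moreover have "c * (h + 1) \<le> c * (2 * h)"
    using \<open>1 \<le> h\<close> by (intro mult_le_mono2) simp
  moreover have "c * (2 * h) = 4 * (2 * (k + 1) * h)" by (simp add: c_def algebra_simps)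
  ultimately have cardY: "m \<le> 4 * card Y"
    using mch by linarith
  have "\<exists>s e. long_period T s e d \<and> s \<le> y \<and> y < e \<and> charges k j t s e" if y: "y \<in> Y" for y
  proof -
    obtain u where u: "v \<le> u" "u \<le> y" "y < u + h" "u + h \<le> v + c * h" "{u..<u + h} \<inter> E = {}"
      using cell [OF y] by blast
    have "u + h + d \<le> p2 + 2 * l2"
      using u(4) chm x2 l2 by (simp add: v_def l2_def)
    then have "u + h + d \<le> length T" using mm by simp
    moreover have "T ! i = T ! (i + d)" if "u \<le> i" "i + d < u + h + d" for i
      using u chm that by (auto simp: E_def)
    ultimately have "periodic_on T d u (u + h + d)"
      by (auto simp: periodic_on_def)
    then obtain s e where se: "s \<le> u" "u + h + d \<le> e" "maximal_periodic T d s e"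
      by (rule ex_maximal_periodic)
    have "long_period T s e d"
      using se hd d by (simp add: long_period_def)
    moreover have "2 ^ j \<le> 4 * (k + 1) * (e - s)"
    proof -
      have "h + 1 \<le> e - s" using se d by simp
      then have "c * (h + 1) \<le> c * (e - s)" by (rule mult_le_mono2)
      with mch show ?thesis by (simp add: c_def m_def)
    qed
    \<comment> \<open>Otherwise \<open>l1 \<le> d * (k + 1)\<close>, far below \<open>2 * m\<close>.
      So one endpoint falls inside the square at \<open>p1\<close>, close to the block.\<close>
    moreover have "\<not> (s \<le> p1 \<and> p1 + 2 * l1 \<le> e)"
    proof
      assume *: "s \<le> p1 \<and> p1 + 2 * l1 \<le> e"
      have "periodic_on T d p1 (p1 + 2 * l1)"
        using se(3) * by (auto simp: maximal_periodic_def periodic_on_def)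
      from periodic_many_mismatches [OF this d] mm have "l1 \<le> d * (k + 1)" by simp
      then have "l1 \<le> (k + 1) * d" by (simp only: mult.commute)
      moreover have "1 \<le> (k + 1) * d" using d by simp
      ultimately show False using dm l1 by linarith
    qed
    then have "x \<le> s \<and> s < x + 10 * m \<or> x \<le> e \<and> e < x + 10 * m"
      using x1 l1 se u chm by (auto simp: v_def)
    then have "m * t \<le> s \<and> s < (t + 10) * m \<or> m * t \<le> e \<and> e < (t + 10) * m"
      by (simp add: x_def algebra_simps)
    then have "t \<le> s div m \<and> s div m < t + 10 \<or> t \<le> e div m \<and> e div m < t + 10"
      by (auto simp: m_def less_eq_div_iff_mult_less_eq div_less_iff_less_mult mult.commute)
    ultimately have "long_period T s e d" "charges k j t s e"
      by (auto simp: charges_def m_def)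
    with se u show ?thesis by force
  qed
  \<comment> \<open>As \<open>2 * m \<le> l1 < 4 * m\<close>, these bounds depend on the block
    alone.\<close>
  moreover have "Y \<subseteq> {2 ^ j * (t + 3)..<2 ^ j * (t + 6)}"
    using Y(1) chm l1 by (force simp: v_def x_def m_def algebra_simps)
  ultimately show thesis
    using that d card_d cardY unfolding m_def by blast
qed

section \<open>Charging blocks to periodic fragments\<close>

text \<open>Up to a factor 3, the numerator bounds the part of the fragment inside the range of
  \<open>Y\<close>. Dividing by the minimal period makes the weight independent of the block's
  \<open>d\<close>.\<close>

definition run_weight :: "'a list \<Rightarrow> nat \<Rightarrow> nat \<times> nat \<Rightarrow> real" where
  "run_weight T j R =
     min (real (snd R - fst R)) (2 ^ j) / real (min_period T (fst R) (snd R))"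

text \<open>With \<open>P\<close> periods,
  \<open>P \<le> 4 * 2 ^ j / d \<le> 16 * card Y / d\<close>, and \<open>Y\<close> is covered by
  charged fragments. Each covers at most \<open>3 * min |R| (2 ^ j)\<close> positions and has
  minimal period at most \<open>d\<close>; hence \<open>48 = 16 * 3\<close>.\<close>

lemma dense_block_le:
  assumes dense: "65 * (k + 1) < card (snd ` block k T j t)"
  shows "real (card (snd ` block k T j t)) \<le>
    48 * (\<Sum>R | R \<in> long_runs T \<and> charges k j t (fst R) (snd R). run_weight T j R)"
proof -
  let ?P = "real (card (snd ` block k T j t))"
  obtain d Y where d: "1 \<le> d" and card: "card (snd ` block k T j t) * d \<le> 4 * 2 ^ j"
    and Y: "Y \<subseteq> {2 ^ j * (t + 3)..<2 ^ j * (t + 6)}" and cardY: "2 ^ j \<le> 4 * card Y"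
    and run: "\<And>y. y \<in> Y \<Longrightarrow> \<exists>s e. long_period T s e d \<and> s \<le> y \<and> y < e \<and> charges k j t s e"
    using dense_block [OF dense] by blast
  define \<R> where "\<R> = {R \<in> long_runs T. charges k j t (fst R) (snd R)}"
  define \<D> where "\<D> = {R \<in> \<R>. long_period T (fst R) (snd R) d}"
  define Z where "Z R = {fst R..<snd R} \<inter> {2 ^ j * (t + 3)..<2 ^ j * (t + 6)}" for R :: "nat \<times> nat"
  have fin: "finite \<R>" "finite \<D>"
    by (auto simp: \<R>_def \<D>_def)
  have "Y \<subseteq> (\<Union>R\<in>\<D>. Z R)"
  proof
    fix y assume y: "y \<in> Y"
    then obtain s e where "long_period T s e d" "s \<le> y" "y < e" "charges k j t s e"
      using run by blast
    then have "(s, e) \<in> \<D>" "y \<in> Z (s, e)"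
      using y Y by (auto simp: \<D>_def \<R>_def Z_def long_runs_def)
    then show "y \<in> (\<Union>R\<in>\<D>. Z R)" by blast
  qed
  then have "card Y \<le> card (\<Union>R\<in>\<D>. Z R)"
    using fin by (intro card_mono) (auto simp: Z_def)
  also have "\<dots> \<le> (\<Sum>R\<in>\<D>. card (Z R))"
    using fin by (intro card_UN_le)
  finally have Ysum: "real (card Y) \<le> (\<Sum>R\<in>\<D>. real (card (Z R)))"
    by (metis of_nat_le_iff of_nat_sum)
  have bound: "real (card (Z R)) / real d \<le> 3 * run_weight T j R" if "R \<in> \<D>" for R
  proof -
    let ?q = "min_period T (fst R) (snd R)"
    have lp: "long_period T (fst R) (snd R) d" and "R \<in> long_runs T"
      using that by (auto simp: \<D>_def \<R>_def)
    then have q: "?q \<le> d" "1 \<le> ?q"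
      using min_period_le [OF lp] long_period_min_period [of "fst R" "snd R" T]
      by (auto simp: long_period_def)
    have "card (Z R) \<le> card {fst R..<snd R}" "card (Z R) \<le> card {2 ^ j * (t + 3)..<2 ^ j * (t + 6)}"
      unfolding Z_def by (intro card_mono; simp)+
    then have "card (Z R) \<le> snd R - fst R" "card (Z R) \<le> 3 * 2 ^ j"
      by (simp_all add: algebra_simps)
    then have "real (card (Z R)) \<le> real (snd R - fst R)" "real (card (Z R)) \<le> real (3 * 2 ^ j)"
      by (simp_all only: of_nat_le_iff)
    then have "real (card (Z R)) \<le> 3 * min (real (snd R - fst R)) (2 ^ j)"
      by auto
    then have "real (card (Z R)) / real d \<le> 3 * min (real (snd R - fst R)) (2 ^ j) / real ?q"
      using q by (intro frac_le) auto
    then show ?thesis by (simp add: run_weight_def)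
  qed
  have "real (card (snd ` block k T j t) * d) \<le> real (4 * 2 ^ j)" "real (2 ^ j) \<le> real (4 * card Y)"
    using card cardY by (simp_all only: of_nat_le_iff)
  then have "?P * real d \<le> 16 * real (card Y)" by simp
  then have "?P \<le> 16 * (real (card Y) / real d)"
    using d by (simp add: field_simps)
  also have "\<dots> \<le> 16 * ((\<Sum>R\<in>\<D>. real (card (Z R))) / real d)"
    using Ysum by (intro mult_left_mono divide_right_mono) auto
  also have "\<dots> = 16 * (\<Sum>R\<in>\<D>. real (card (Z R)) / real d)"
    by (simp add: sum_divide_distrib)
  also have "\<dots> \<le> 16 * (\<Sum>R\<in>\<D>. 3 * run_weight T j R)"
    using bound by (intro mult_left_mono sum_mono) auto
  also have "\<dots> = 48 * (\<Sum>R\<in>\<D>. run_weight T j R)"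
    by (simp add: sum_distrib_left [symmetric])
  also have "\<dots> \<le> 48 * (\<Sum>R\<in>\<R>. run_weight T j R)"
    using fin by (intro mult_left_mono sum_mono2) (auto simp: \<D>_def run_weight_def)
  finally show ?thesis by (simp add: \<R>_def)
qed

text \<open>The minimum accounts for sparse blocks, the sum for dense ones; each period has at most
  \<open>k + 1\<close> starts.\<close>

lemma block_le:
  "real (card (block k T j t)) \<le> real (k + 1) *
    (min (2 * 2 ^ j) (65 * real (k + 1)) +
     48 * (\<Sum>R | R \<in> long_runs T \<and> charges k j t (fst R) (snd R). run_weight T j R))"
  (is "_ \<le> _ * (?m + 48 * ?s)")
proof -
  have s: "0 \<le> ?s"
    by (intro sum_nonneg) (auto simp: run_weight_def)
  have "real (card (snd ` block k T j t)) \<le> ?m + 48 * ?s"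
  proof (cases "65 * (k + 1) < card (snd ` block k T j t)")
    case True
    have "0 \<le> ?m" by simp
    with dense_block_le [OF True] show ?thesis by linarith
  next
    case False
    then have "real (card (snd ` block k T j t)) \<le> real (65 * (k + 1))"
      "real (card (snd ` block k T j t)) \<le> real (2 * 2 ^ j)"
      using card_block_periods_le by (simp_all only: of_nat_le_iff not_less)
    with s show ?thesis by simp
  qed
  then have "real (k + 1) * real (card (snd ` block k T j t)) \<le> real (k + 1) * (?m + 48 * ?s)"
    by (intro mult_left_mono) auto
  moreover have "real (card (block k T j t)) \<le> real ((k + 1) * card (snd ` block k T j t))"
    using card_block_le by (simp only: of_nat_le_iff)
  ultimately show ?thesis
    unfolding of_nat_mult by (rule order.trans [rotated])
qed

section \<open>Sums over the dyadic scales\<close>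

text \<open>The first \<open>a\<close> scales contribute at most 1 each, the later ones a geometric
  series with sum 2.\<close>

lemma sum_min_one_le:
  fixes c :: real
  assumes J: "finite J" and c: "0 \<le> c" "c \<le> 2 ^ a"
  shows "(\<Sum>j\<in>J. min 1 (c / 2 ^ j)) \<le> real a + 2"
proof -
  obtain N where "\<forall>j\<in>J. j < N"
    using J by (auto simp: finite_nat_set_iff_bounded)
  then have N: "J \<subseteq> {..<a + N}" by force
  have "(\<Sum>j\<in>J. min 1 (c / 2 ^ j)) \<le> (\<Sum>j<a + N. min 1 (c / 2 ^ j))"
    using N c by (intro sum_mono2) auto
  also have "\<dots> = (\<Sum>j<a. min 1 (c / 2 ^ j)) + (\<Sum>i<N. min 1 (c / 2 ^ (i + a)))"
    by (induction N) (simp_all add: ac_simps)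
  also have "\<dots> \<le> (\<Sum>j<a. 1) + (\<Sum>i<N. (1 / 2) ^ i)"
  proof (intro add_mono sum_mono)
    fix i
    have "c / 2 ^ (i + a) \<le> 2 ^ a / 2 ^ (i + a)"
      using c by (intro divide_right_mono) auto
    also have "\<dots> = (1 / 2) ^ i"
      by (simp add: power_add power_one_over)
    finally show "min 1 (c / 2 ^ (i + a)) \<le> (1 / 2) ^ i" by simp
  qed auto
  also have "(\<Sum>i<N. (1 / 2) ^ i) \<le> (\<Sum>i. (1 / 2 :: real) ^ i)"
    by (rule sum_le_suminf) (auto simp: summable_geometric)
  also have "\<dots> = 2"
    by (simp add: suminf_geometric)
  finally show ?thesis by simp
qed

text \<open>Scales below \<open>floor_log r\<close> sum geometrically to at most \<open>r\<close>;
  at most \<open>a + 1\<close> scales remain, each contributing at most \<open>r\<close>.\<close>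

lemma sum_min_power_le:
  fixes r :: nat
  assumes r: "1 \<le> r" and J: "\<And>j. j \<in> J \<Longrightarrow> 2 ^ j \<le> 2 ^ a * r"
  shows "(\<Sum>j\<in>J. min (real r) (2 ^ j)) \<le> real r * (real a + 2)"
proof -
  define b where "b = floor_log r"
  have b: "2 ^ b \<le> r" "r < 2 * 2 ^ b"
    using floor_log_exp2_le [of r] floor_log_exp2_gt [of r] r by (auto simp: b_def)
  have "J \<subseteq> {..<b + (a + 1)}"
  proof
    fix j assume "j \<in> J"
    then have "2 ^ j \<le> 2 ^ a * r" by (rule J)
    also have "\<dots> < 2 ^ a * (2 * 2 ^ b)" using b by simp
    also have "\<dots> = 2 ^ (b + (a + 1))" by (simp add: power_add)
    finally have "(2::nat) ^ j < 2 ^ (b + (a + 1))" .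
    then show "j \<in> {..<b + (a + 1)}"
      by (simp only: power_strict_increasing_iff lessThan_iff one_less_numeral_iff semiring_norm)
  qed
  then have "(\<Sum>j\<in>J. min (real r) (2 ^ j)) \<le> (\<Sum>j<b + (a + 1). min (real r) (2 ^ j))"
    by (intro sum_mono2) auto
  also have "\<dots> = (\<Sum>j<b. min (real r) (2 ^ j)) + (\<Sum>j=b..<b + (a + 1). min (real r) (2 ^ j))"
    by (simp add: lessThan_atLeast0 sum.atLeastLessThan_concat del: sum.op_ivl_Suc)
  also have "\<dots> \<le> (\<Sum>j<b. 2 ^ j) + (\<Sum>j=b..<b + (a + 1). real r)"
    by (intro add_mono sum_mono) auto
  also have "(\<Sum>j<b. (2::real) ^ j) \<le> real r"
  proof -
    have "(\<Sum>j<b. (2::real) ^ j) = 2 ^ b - 1"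
      by (simp add: geometric_sum)
    also have "\<dots> \<le> real (2 ^ b)" by simp
    also have "\<dots> \<le> real r" using b by (simp only: of_nat_le_iff)
    finally show ?thesis .
  qed
  finally show ?thesis by (simp add: algebra_simps)
qed

lemma card_charging_blocks: "card {t \<in> A. charges k j t s e} \<le> 20"
proof -
  have "{t \<in> A. charges k j t s e} \<subseteq> {s div 2 ^ j - 9..s div 2 ^ j} \<union> {e div 2 ^ j - 9..e div 2 ^ j}"
    by (auto simp: charges_def)
  then have "card {t \<in> A. charges k j t s e}
      \<le> card ({s div 2 ^ j - 9..s div 2 ^ j} \<union> {e div 2 ^ j - 9..e div 2 ^ j})"
    by (intro card_mono) auto
  also have "\<dots> \<le> card {s div 2 ^ j - 9..s div 2 ^ j} + card {e div 2 ^ j - 9..e div 2 ^ j}"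
    by (rule card_Un_le)
  also have "\<dots> \<le> 20" by simp
  finally show ?thesis .
qed

section \<open>Total over all blocks\<close>

text \<open>Blocks contain only periods \<open>l \<ge> 2\<close>, at scale
  \<open>floor_log (l div 2)\<close>; period 1 is listed separately.\<close>

lemma run_starts_subset:
  fixes T :: "'a list"
  defines "n \<equiv> length T"
  shows "run_starts k T \<subseteq> (\<lambda>p. (p, 1)) ` {..<n} \<union>
    (\<Union>j\<in>{j. 2 ^ j \<le> n}. \<Union>t\<in>{..n div 2 ^ j}. block k T j t)"
proof
  fix z assume z: "z \<in> run_starts k T"
  obtain p l where pl: "z = (p, l)" by (cases z)
  have l: "1 \<le> l" "p + 1 + 2 * l \<le> n"
    using z by (auto simp: pl run_starts_def n_def)
  show "z \<in> (\<lambda>p. (p, 1)) ` {..<n} \<union> (\<Union>j\<in>{j. 2 ^ j \<le> n}. \<Union>t\<in>{..n div 2 ^ j}. block k T j t)"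
  proof (cases "l = 1")
    case True
    with l pl show ?thesis by auto
  next
    case False
    define j where "j = floor_log (l div 2)"
    have "floor_log l = Suc j"
      using False l by (simp add: j_def floor_log_rec del: floor_log_half)
    then have j: "2 * 2 ^ j \<le> l" "l < 4 * 2 ^ j"
      using floor_log_exp2_le [of l] floor_log_exp2_gt [of l] l by auto
    then have "z \<in> block k T j (p div 2 ^ j)"
      using z by (simp add: block_def pl)
    moreover have "2 ^ j \<le> n" "p div 2 ^ j \<le> n div 2 ^ j"
      using j l by (auto intro: div_le_mono)
    ultimately show ?thesis by blast
  qed
qed

lemma card_run_starts_le:
  fixes T :: "'a list"
  assumes a: "33 * (k + 1) \<le> 2 ^ a"
  shows "real (card (run_starts k T))
    \<le> real (length T) * (1 + 3844 * (real (k + 1) * (real a + 2)))"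
proof -
  define n where "n = length T"
  define J where "J = {j. 2 ^ j \<le> n}"
  define \<C> where "\<C> j t = {R \<in> long_runs T. charges k j t (fst R) (snd R)}" for j t
  have J: "finite J"
  proof (rule finite_subset)
    show "J \<subseteq> {..n}"
    proof
      fix j assume "j \<in> J"
      then have "2 ^ j \<le> n" by (simp add: J_def)
      moreover have "j < 2 ^ j" by (rule less_exp)
      ultimately have "j < n" by (rule less_le_trans [rotated])
      then show "j \<in> {..n}" by simp
    qed
  qed simp
  have aR: "33 * real (k + 1) \<le> 2 ^ a"
  proof -
    have "real (33 * (k + 1)) \<le> real (2 ^ a)" using a by (simp only: of_nat_le_iff)
    then show ?thesis by simp
  qed
  have "card (run_starts k T) \<le>
      card ((\<lambda>p. (p, 1 :: nat)) ` {..<n} \<union> (\<Union>j\<in>J. \<Union>t\<in>{..n div 2 ^ j}. block k T j t))"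
    using J run_starts_subset [of k T] unfolding n_def J_def by (intro card_mono) auto
  also have "\<dots> \<le> card ((\<lambda>p. (p, 1 :: nat)) ` {..<n}) +
      card (\<Union>j\<in>J. \<Union>t\<in>{..n div 2 ^ j}. block k T j t)"
    by (rule card_Un_le)
  also have "\<dots> \<le> n + (\<Sum>j\<in>J. \<Sum>t\<le>n div 2 ^ j. card (block k T j t))"
    using J card_image_le [of "{..<n}" "\<lambda>p. (p, 1 :: nat)"]
    by (intro add_mono order.trans [OF card_UN_le] sum_mono card_UN_le) auto
  finally have "real (card (run_starts k T)) \<le>
      real (n + (\<Sum>j\<in>J. \<Sum>t\<le>n div 2 ^ j. card (block k T j t)))"
    by (simp only: of_nat_le_iff)
  also have "\<dots> = real n + (\<Sum>j\<in>J. \<Sum>t\<le>n div 2 ^ j. real (card (block k T j t)))"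
    by simp
  also have "(\<Sum>j\<in>J. \<Sum>t\<le>n div 2 ^ j. real (card (block k T j t))) \<le>
      (\<Sum>j\<in>J. \<Sum>t\<le>n div 2 ^ j. real (k + 1) * (min (2 * 2 ^ j) (65 * real (k + 1)) +
        48 * (\<Sum>R\<in>\<C> j t. run_weight T j R)))"
    using block_le unfolding \<C>_def by (intro sum_mono)
  also have "\<dots> = real (k + 1) *
      ((\<Sum>j\<in>J. \<Sum>t\<le>n div 2 ^ j. min (2 * 2 ^ j) (65 * real (k + 1))) +
       48 * (\<Sum>j\<in>J. \<Sum>t\<le>n div 2 ^ j. \<Sum>R\<in>\<C> j t. run_weight T j R))"
    by (simp only: sum_distrib_left [symmetric] sum.distrib)
  also have "(\<Sum>j\<in>J. \<Sum>t\<le>n div 2 ^ j. min (2 * 2 ^ j) (65 * real (k + 1)))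
      \<le> 4 * real n * (real a + 2)"
  proof -
    have "(\<Sum>t\<le>n div 2 ^ j. min (2 * 2 ^ j) (65 * real (k + 1)))
        \<le> 4 * real n * min 1 (33 * real (k + 1) / 2 ^ j)" if "j \<in> J" for j
    proof -
      \<comment> \<open>As \<open>2 ^ j \<le> n\<close>, the additional last block at most doubles
        the count.\<close>
      have "(n div 2 ^ j + 1) * 2 ^ j \<le> 2 * n"
        using that by (simp add: J_def add_mult_distrib mult_2 add_mono)
      then have "real ((n div 2 ^ j + 1) * 2 ^ j) \<le> real (2 * n)"
        by (simp only: of_nat_le_iff)
      then have cnt: "real (n div 2 ^ j + 1) \<le> 2 * real n / 2 ^ j"
        by (simp add: field_simps)
      have "(\<Sum>t\<le>n div 2 ^ j. min (2 * 2 ^ j) (65 * real (k + 1)))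
          = real (n div 2 ^ j + 1) * min (2 * 2 ^ j) (65 * real (k + 1))"
        by simp
      also have "\<dots> \<le> (2 * real n / 2 ^ j) * min (2 * 2 ^ j) (65 * real (k + 1))"
        using cnt by (intro mult_right_mono) auto
      \<comment> \<open>Here 33 is \<open>65 / 2\<close> rounded up.\<close>
      also have "\<dots> \<le> (2 * real n / 2 ^ j) * (2 * 2 ^ j * min 1 (33 * real (k + 1) / 2 ^ j))"
        by (intro mult_left_mono) (auto simp: min_def field_simps)
      also have "\<dots> = 4 * real n * min 1 (33 * real (k + 1) / 2 ^ j)"
        by simp
      finally show ?thesis .
    qed
    then have "(\<Sum>j\<in>J. \<Sum>t\<le>n div 2 ^ j. min (2 * 2 ^ j) (65 * real (k + 1)))
        \<le> (\<Sum>j\<in>J. 4 * real n * min 1 (33 * real (k + 1) / 2 ^ j))"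
      by (rule sum_mono)
    also have "\<dots> = 4 * real n * (\<Sum>j\<in>J. min 1 (33 * real (k + 1) / 2 ^ j))"
      by (simp only: sum_distrib_left)
    also have "\<dots> \<le> 4 * real n * (real a + 2)"
      using J aR by (intro mult_left_mono sum_min_one_le) auto
    finally show ?thesis .
  qed
  also have "(\<Sum>j\<in>J. \<Sum>t\<le>n div 2 ^ j. \<Sum>R\<in>\<C> j t. run_weight T j R)
      \<le> 80 * real n * (real a + 2)"
  proof -
    let ?r = "\<lambda>R. snd R - fst R" and ?q = "\<lambda>R. real (min_period T (fst R) (snd R))"
    \<comment> \<open>Outside these scales \<open>R\<close> is too short to be charged by any
      block.\<close>
    define K where "K R = {j \<in> J. 2 ^ j \<le> 4 * (k + 1) * ?r R}" for R :: "nat \<times> nat"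
    have "(\<Sum>t\<le>n div 2 ^ j. \<Sum>R\<in>\<C> j t. run_weight T j R)
        = (\<Sum>R\<in>long_runs T. \<Sum>t | t \<in> {..n div 2 ^ j} \<and> charges k j t (fst R) (snd R). run_weight T j R)"
      for j
      unfolding \<C>_def by (rule sum.swap_restrict) auto
    then have "(\<Sum>j\<in>J. \<Sum>t\<le>n div 2 ^ j. \<Sum>R\<in>\<C> j t. run_weight T j R)
        = (\<Sum>R\<in>long_runs T. \<Sum>j\<in>J.
            real (card {t \<in> {..n div 2 ^ j}. charges k j t (fst R) (snd R)}) * run_weight T j R)"
      by (subst sum.swap) simp
    also have "\<dots> \<le> (\<Sum>R\<in>long_runs T. \<Sum>j\<in>K R. 20 * run_weight T j R)"
    proof (rule sum_mono)
      fix R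
      have "{t \<in> {..n div 2 ^ j}. charges k j t (fst R) (snd R)} = {}" if "j \<in> J - K R" for j
        using that by (auto simp: K_def charges_def)
      then have "(\<Sum>j\<in>J. real (card {t \<in> {..n div 2 ^ j}. charges k j t (fst R) (snd R)}) * run_weight T j R)
          = (\<Sum>j\<in>K R. real (card {t \<in> {..n div 2 ^ j}. charges k j t (fst R) (snd R)}) * run_weight T j R)"
        using J by (intro sum.mono_neutral_right) (auto simp: K_def simp del: Collect_empty_eq)
      also have "\<dots> \<le> (\<Sum>j\<in>K R. 20 * run_weight T j R)"
      proof (intro sum_mono mult_right_mono)
        fix j
        show "real (card {t \<in> {..n div 2 ^ j}. charges k j t (fst R) (snd R)}) \<le> 20"
          using card_charging_blocks [of "{..n div 2 ^ j}" k j "fst R" "snd R"] by simp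
      qed (simp add: run_weight_def)
      finally show "(\<Sum>j\<in>J. real (card {t \<in> {..n div 2 ^ j}. charges k j t (fst R) (snd R)}) * run_weight T j R)
          \<le> (\<Sum>j\<in>K R. 20 * run_weight T j R)" .
    qed
    also have "\<dots> \<le> (\<Sum>R\<in>long_runs T. 20 * (real a + 2) * (real (?r R) / ?q R))"
    proof (rule sum_mono)
      fix R assume "R \<in> long_runs T"
      then have "long_period T (fst R) (snd R) (min_period T (fst R) (snd R))"
        using long_period_min_period [of "fst R" "snd R" T] by simp
      then have r: "1 \<le> ?r R" by (auto simp: long_period_def)
      have "4 * (k + 1) * ?r R \<le> 2 ^ a * ?r R"
        using a by (intro mult_le_mono1) simp
      then have "2 ^ j \<le> 2 ^ a * ?r R" if "j \<in> K R" for j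
        using that unfolding K_def mem_Collect_eq by (blast intro: order.trans)
      with r have "(\<Sum>j\<in>K R. min (real (?r R)) (2 ^ j)) \<le> real (?r R) * (real a + 2)"
        by (rule sum_min_power_le)
      then have "20 * ((\<Sum>j\<in>K R. min (real (?r R)) (2 ^ j)) / ?q R)
          \<le> 20 * (real (?r R) * (real a + 2) / ?q R)"
        by (intro mult_left_mono divide_right_mono) auto
      also have "\<dots> = 20 * (real a + 2) * (real (?r R) / ?q R)"
        by (simp only: times_divide_eq_right mult_ac)
      finally show "(\<Sum>j\<in>K R. 20 * run_weight T j R) \<le> 20 * (real a + 2) * (real (?r R) / ?q R)"
        by (simp only: run_weight_def sum_distrib_left [symmetric] sum_divide_distrib [symmetric])
    qed
    also have "\<dots> = 20 * (real a + 2) * (\<Sum>R\<in>long_runs T. real (?r R) / ?q R)"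
      by (simp only: sum_distrib_left)
    also have "\<dots> \<le> 20 * (real a + 2) * (4 * real n)"
      using sum_exponents_long_runs [of T] unfolding n_def by (intro mult_left_mono) auto
    finally show ?thesis by (simp add: algebra_simps)
  qed
  finally have "real (card (run_starts k T)) \<le> real n +
      real (k + 1) * (4 * real n * (real a + 2) + 48 * (80 * real n * (real a + 2)))"
    by simp
  \<comment> \<open>\<open>3844 = 4 + 48 * 80\<close>, where \<open>80 = 20 * 4\<close> combines the
    blocks charging a fragment per scale with the bound on the exponents.\<close>
  also have "\<dots> = real n * (1 + 3844 * (real (k + 1) * (real a + 2)))"
    by (simp add: algebra_simps)
  finally show ?thesis by (simp add: n_def)
qed

section \<open>The explicit constant\<close>

theorem theorem1:
  "\<exists>C::real. C > 0 \<and>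
     (\<forall>(k::nat) (T::'a list). k \<ge> 1 \<longrightarrow>
        real (card (k_runs k T)) \<le> C * (real (length T) * real k * max 1 (log 2 (real k))))"
proof (intro exI [of _ 80000] conjI allI impI)
  fix k :: nat and T :: "'a list" assume k: "1 \<le> k"
  define n where "n = length T"
  define b where "b = floor_log k"
  define M where "M = max 1 (log 2 (real k))"
  have M: "1 \<le> M" by (simp add: M_def)
  have kM: "1 \<le> real k * M"
    using mult_mono [of 1 "real k" 1 M] k M by simp
  have "2 ^ b \<le> k" using k floor_log_exp2_le [of k] by (simp add: b_def)
  then have "real b \<le> log 2 (real k)"
    using k by (metis le_log2_of_power)
  then have b: "real (b + 7) + 2 \<le> 10 * M" by (simp add: M_def)
  have "k + 1 \<le> 2 * 2 ^ b"
    using floor_log_exp2_gt [of k] by (simp add: b_def)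
  \<comment> \<open>\<open>33 * 2 \<le> 2 ^ 7\<close>, so \<open>a = b + 7\<close> is admissible,
    and \<open>a + 2\<close> is at most \<open>10 * M\<close>.\<close>
  then have "33 * (k + 1) \<le> 2 ^ (b + 7)"
    by (simp add: power_add)
  from card_run_starts_le [OF this, of T]
  have "real (card (run_starts k T)) \<le> real n * (1 + 3844 * (real (k + 1) * (real (b + 7) + 2)))"
    by (simp add: n_def)
  also have "\<dots> \<le> real n * (1 + 3844 * ((2 * real k) * (10 * M)))"
    using b k by (intro mult_left_mono add_left_mono mult_mono) auto
  also have "\<dots> \<le> real n * (real k * M + 3844 * ((2 * real k) * (10 * M)))"
    using kM by (intro mult_left_mono add_right_mono) auto
  \<comment> \<open>\<open>76881 = 1 + 3844 * 2 * 10\<close>; runs starting at position 1 add one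
    more, which 80000 absorbs.\<close>
  finally have starts: "real (card (run_starts k T)) \<le> 76881 * (real n * (real k * M))"
    by (simp add: algebra_simps)
  have "real n * 1 \<le> real n * (real k * M)"
    using kM by (intro mult_left_mono) auto
  moreover have "real (card (k_runs k T)) \<le> real (n + card (run_starts k T))"
    using card_k_runs_le by (simp only: of_nat_le_iff n_def)
  moreover have "0 \<le> real n * (real k * M)"
    using M by simp
  ultimately have "real (card (k_runs k T)) \<le> 80000 * (real n * (real k * M))"
    using starts by (simp add: algebra_simps)
  then show "real (card (k_runs k T)) \<le>
      80000 * (real (length T) * real k * max 1 (log 2 (real k)))"
    by (simp add: n_def M_def mult.assoc)
qed simp

end
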